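(* Let $R$ be an associative ring with unit $1$ (not necessarily commutative), let $\mathcal A$ be a set (alphabet, not necessarily finite), and let $k\geq 2$ be an integer. Let $M_1,\dots,M_k$ be matrices with rows and columns indexed by $\mathcal A$ and entries $M_j(\alpha,\beta)\in R$. For $\alpha\in\mathcal A$ let $g_\alpha$ be the formal power series of the form $g_\alpha=Y_\alpha X^k+(\text{terms of higher degree in }X)$ satisfying $$g_\alpha=Y_\alpha\,(X-(M_1V)_\alpha)(X-(M_2V)_\alpha)\cdots(X-(M_kV)_\alpha),$$ where $V$ is the column vector $(g_\beta)_{\beta\in\mathcal A}$ and $(M_jV)_\alpha=\sum_{\beta\in\mathcal A}M_j(\alpha,\beta)g_\beta$. Let $J$ be the matrix indexed by $\mathcal A\times\mathcal A$ with all entries $1$, let $\tilde M_j=J-M_j$ (so $\tilde M_j(\alpha,\beta)=1-M_j(\alpha,\beta)$), and for $\alpha\in\mathcal A$ let $\tilde g_\alpha$ be the formal power series of the form $\tilde g_\alpha=Y_\alpha(-X)^k+(\text{terms of higher degree in }X)$ satisfying $$\tilde g_\alpha=Y_\alpha\,(-X+(\tilde M_1\tilde V)_\alpha)\cdots(-X+(\tilde M_k\tilde V)_\alpha),$$ where $\tilde V=(\tilde g_\beta)_{\beta\in\mathcal A}$. Set $g=-X+\sum_{\alpha\in\mathcal A}g_\alpha$ and $\tilde g=-X+\sum_{\alpha\in\mathcal A}\tilde g_\alpha$. Then, formally, $$g\circ_X\tilde g=\tilde g\circ_X g=X.$$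
   Context: $(Y_\alpha)_{\alpha\in\mathcal A}$ and $X$ are non-commuting variables (they commute neither with each other nor with elements of $R$). The formal power series considered are (possibly infinite) formal sums of monomials $\pm r_1Z_1r_2Z_2\cdots r_lZ_lr_{l+1}$ with $r_i\in R$ and $Z_i\in\{X\}\cup\{Y_\alpha:\alpha\in\mathcal A\}$; the degree in $X$ of a monomial is the number of occurrences of $X$ in it. The conditions on lowest-order terms together with $k\ge 2$ determine $g_\alpha,\tilde g_\alpha$ uniquely (coefficients can be computed recursively by $X$-degree). For formal power series $f,h$ such that every monomial of $h$ has degree at least $1$ in $X$, the composition $f\circ_X h$ is the series obtained by replacing every occurrence of $X^m$ ($m=1,2,\dots$) in every monomial of $f$ by $h^m$ (i.e. each occurrence of $X$ by $h$). *)

theory Defs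
  imports "HOL-Library.Multiset"
begin

text \<open>
  Formal power series over an associative unital ring \<open>'r\<close> in the variables \<open>X\<close> and
  \<open>Y\<^sub>\<alpha>\<close> (\<open>\<alpha> :: 'a\<close>), which commute neither with each other nor with the coefficients.
  The sort \<open>{ring, monoid_mult}\<close> is used for the coefficient ring instead of \<open>ring_1\<close>, because
  the latter excludes the zero ring.
\<close>

datatype 'a letter = LX | LY 'a

section \<open>Monomials\<close>

text \<open>\<open>Step r\<^sub>1 Z\<^sub>1 (\<dots> (Step r\<^sub>l Z\<^sub>l (Scal r\<^sub>l\<^sub>+\<^sub>1)))\<close> is the monomial
  \<open>r\<^sub>1 Z\<^sub>1 \<dots> r\<^sub>l Z\<^sub>l r\<^sub>l\<^sub>+\<^sub>1\<close>.  Signs are absorbed in the first coefficient.\<close>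

datatype ('a, 'r) mono = Scal 'r | Step 'r "'a letter" "('a, 'r) mono"

primrec word :: "('a, 'r) mono \<Rightarrow> 'a letter list" where
  "word (Scal r) = []"
| "word (Step r Z m) = Z # word m"

primrec mono_scale :: "'r::times \<Rightarrow> ('a, 'r) mono \<Rightarrow> ('a, 'r) mono" where
  "mono_scale r (Scal s) = Scal (r * s)"
| "mono_scale r (Step s Z m) = Step (r * s) Z m"

primrec mono_neg :: "('a, 'r::uminus) mono \<Rightarrow> ('a, 'r) mono" where
  "mono_neg (Scal s) = Scal (- s)"
| "mono_neg (Step s Z m) = Step (- s) Z m"

instantiation mono :: (type, monoid_mult) monoid_mult
begin

definition one_mono :: "('a, 'b) mono" where
  "1 = Scal 1"

primrec times_mono :: "('a, 'b) mono \<Rightarrow> ('a, 'b) mono \<Rightarrow> ('a, 'b) mono" where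
  "Scal r * n = mono_scale r n"
| "Step r Z m * n = Step r Z (m * n)"

instance
proof
  fix a b c :: "('a, 'b) mono"
  have scale: "mono_scale r (m * n) = mono_scale r m * n" for r and m n :: "('a, 'b) mono"
    by (cases m; cases n) (auto simp: mult.assoc)
  show "a * b * c = a * (b * c)"
    by (induction a) (auto simp: scale)
  show "1 * a = a" by (cases a) (auto simp: one_mono_def)
  show "a * 1 = a" by (induction a) (auto simp: one_mono_def)
qed

end

lemma mono_times_comp: "(*) (m * n) = (*) m \<circ> (*) (n :: ('a, 'r::monoid_mult) mono)"
  by (simp add: fun_eq_iff mult.assoc)

lemma mono_times_1: "(*) 1 = (\<lambda>m :: ('a, 'r::monoid_mult) mono. m)"
  by (simp add: fun_eq_iff)

lemma word_scale [simp]: "word (mono_scale r m) = word m"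
  by (cases m) auto

lemma word_neg [simp]: "word (mono_neg m) = word m"
  by (cases m) auto

lemma word_times [simp]: "word (m * n) = word m @ word n"
  by (induction m) auto

lemma word_one [simp]: "word 1 = []"
  by (simp add: one_mono_def)

lemma mono_neg_times:
  fixes m n :: "('a, 'r::{ring,monoid_mult}) mono"
  shows "mono_neg (m * n) = mono_neg m * n"
  by (cases m; cases n) auto

section \<open>Polynomials: finite formal sums of monomials\<close>

text \<open>Two finite formal sums are identified iff this follows from additivity of monomials in each
  of their coefficients.  The part of the quotient spanned by the monomials with a fixed
  word of length \<open>l\<close> is therefore the \<open>(l+1)\<close>-fold tensor power of \<open>'r\<close> over the integers.\<close>

inductive multilin_eq ::
  "('a, 'r::{ring,monoid_mult}) mono multiset \<Rightarrow> ('a, 'r) mono multiset \<Rightarrow> bool" where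
  split: "multilin_eq {#m * Scal (a + b) * n#} {#m * Scal a * n, m * Scal b * n#}"
| zero: "multilin_eq {#m * Scal 0 * n#} {#}"
| cong: "multilin_eq p q \<Longrightarrow> multilin_eq (p + u) (q + u)"
| refl: "multilin_eq p p"
| sym: "multilin_eq p q \<Longrightarrow> multilin_eq q p"
| trans: "multilin_eq p q \<Longrightarrow> multilin_eq q u \<Longrightarrow> multilin_eq p u"

lemma multilin_eq_add:
  assumes "multilin_eq p q" "multilin_eq p' q'"
  shows "multilin_eq (p + p') (q + q')"
proof -
  have "multilin_eq (p + p') (q + p')" using assms(1) by (rule multilin_eq.cong)
  moreover have "multilin_eq (q + p') (q + q')"
    using multilin_eq.cong[OF assms(2), of q] by (simp add: add.commute)
  ultimately show ?thesis by (rule multilin_eq.trans)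
qed

quotient_type (overloaded) ('a, 'r) ncpoly =
  "('a, 'r::{ring,monoid_mult}) mono multiset" / multilin_eq
  by (intro equivpI reflpI sympI transpI) (auto intro: multilin_eq.intros)

definition mset_times :: "('a, 'r::monoid_mult) mono multiset \<Rightarrow> ('a, 'r) mono multiset
    \<Rightarrow> ('a, 'r) mono multiset" where
  "mset_times p q = (\<Sum>m\<in>#p. image_mset ((*) m) q)"

lemma mset_times_simps [simp]:
  "mset_times {#} q = {#}"
  "mset_times (add_mset m p) q = image_mset ((*) m) q + mset_times p q"
  "mset_times (p + p') q = mset_times p q + mset_times p' q"
  "mset_times p {#} = {#}"
  "mset_times p (add_mset n q) = image_mset (\<lambda>m. m * n) p + mset_times p q"
  "mset_times p (q + q') = mset_times p q + mset_times p q'"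
proof -
  show *: "mset_times p (add_mset n q) = image_mset (\<lambda>m. m * n) p + mset_times p q" for n q
    by (induction p) (auto simp: mset_times_def)
  show "mset_times p {#} = {#}"
    by (induction p) (auto simp: mset_times_def)
  then show "mset_times p (q + q') = mset_times p q + mset_times p q'"
    by (induction q) (auto simp: *)
qed (auto simp: mset_times_def)

lemma mset_times_assoc: "mset_times (mset_times p q) r = mset_times p (mset_times q r)"
proof -
  have *: "mset_times (image_mset ((*) m) q) r = image_mset ((*) m) (mset_times q r)" for m
    by (induction q) (auto simp: mono_times_comp multiset.map_comp[symmetric] mult.assoc)
  show ?thesis by (induction p) (auto simp: *)
qed

lemma multilin_eq_image_left:
  "multilin_eq p q \<Longrightarrow> multilin_eq (image_mset ((*) m) p) (image_mset ((*) m) q)"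
proof (induction rule: multilin_eq.induct)
  case (split m' a b n)
  show ?case using multilin_eq.split[of "m * m'" a b n] by (simp add: mult.assoc del: times_mono.simps)
next
  case (zero m' n)
  show ?case using multilin_eq.zero[of "m * m'" n] by (simp add: mult.assoc del: times_mono.simps)
qed (auto intro: multilin_eq.intros)

lemma multilin_eq_image_right:
  "multilin_eq p q \<Longrightarrow> multilin_eq (image_mset (\<lambda>m. m * n) p) (image_mset (\<lambda>m. m * n) q)"
proof (induction rule: multilin_eq.induct)
  case (split m a b n')
  show ?case using multilin_eq.split[of m a b "n' * n"] by (simp add: mult.assoc del: times_mono.simps)
next
  case (zero m n')
  show ?case using multilin_eq.zero[of m "n' * n"] by (simp add: mult.assoc del: times_mono.simps)
qed (auto intro: multilin_eq.intros)

lemma multilin_eq_neg: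
  "multilin_eq p q \<Longrightarrow> multilin_eq (image_mset mono_neg p) (image_mset mono_neg q)"
proof (induction rule: multilin_eq.induct)
  case (split m a b n)
  show ?case using multilin_eq.split[of "mono_neg m" a b n] by (simp add: mono_neg_times)
next
  case (zero m n)
  show ?case using multilin_eq.zero[of "mono_neg m" n] by (simp add: mono_neg_times)
qed (auto intro: multilin_eq.intros)

lemma multilin_eq_times:
  assumes "multilin_eq p q" "multilin_eq p' q'"
  shows "multilin_eq (mset_times p p') (mset_times q q')"
proof -
  have "multilin_eq (mset_times p p') (mset_times q p')"
    using assms(1)
    by (induction p') (auto intro: multilin_eq.refl multilin_eq_add multilin_eq_image_right)
  moreover have "multilin_eq (mset_times q p') (mset_times q q')"
    using assms(2)
    by (induction q) (auto intro: multilin_eq.refl multilin_eq_add multilin_eq_image_left)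
  ultimately show ?thesis by (rule multilin_eq.trans)
qed

lemma multilin_eq_add_neg: "multilin_eq (image_mset mono_neg p + p) {#}"
proof (induction p)
  case (add m p)
  obtain r n where m: "m = 1 * Scal r * n" "mono_neg m = 1 * Scal (- r) * n"
  proof (cases m)
    case (Scal s)
    then show ?thesis using that[of s 1] by (simp add: one_mono_def)
  next
    case (Step s Z m')
    then show ?thesis using that[of s "Step 1 Z m'"] by (simp add: one_mono_def)
  qed
  have "multilin_eq {#mono_neg m, m#} {#1 * Scal (- r + r) * n#}"
    using multilin_eq.sym[OF multilin_eq.split[of 1 "- r" r n]]
    unfolding m(1)[symmetric] m(2)[symmetric] .
  also have "- r + r = 0" by simp
  finally have "multilin_eq {#mono_neg m, m#} {#}"
    by (rule multilin_eq.trans) (rule multilin_eq.zero)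
  from multilin_eq_add[OF this add] show ?case by (simp add: add_mset_commute)
qed (auto intro: multilin_eq.refl)

instantiation ncpoly :: (type, "{ring,monoid_mult}") "{ring,monoid_mult}"
begin

lift_definition zero_ncpoly :: "('a, 'b) ncpoly" is "{#}" .

lift_definition one_ncpoly :: "('a, 'b) ncpoly" is "{#1#}" .

lift_definition plus_ncpoly :: "('a, 'b) ncpoly \<Rightarrow> ('a, 'b) ncpoly \<Rightarrow> ('a, 'b) ncpoly" is "(+)"
  by (rule multilin_eq_add)

lift_definition uminus_ncpoly :: "('a, 'b) ncpoly \<Rightarrow> ('a, 'b) ncpoly" is "image_mset mono_neg"
  by (rule multilin_eq_neg)

definition minus_ncpoly :: "('a, 'b) ncpoly \<Rightarrow> ('a, 'b) ncpoly \<Rightarrow> ('a, 'b) ncpoly" where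
  "p - q = p + (- q)" for p q :: "('a, 'b) ncpoly"

lift_definition times_ncpoly :: "('a, 'b) ncpoly \<Rightarrow> ('a, 'b) ncpoly \<Rightarrow> ('a, 'b) ncpoly"
  is mset_times
  by (rule multilin_eq_times)

instance
proof
  fix a b c :: "('a, 'b) ncpoly"
  show "a + b + c = a + (b + c)"
    by transfer (simp add: add.assoc multilin_eq.refl)
  show "a + b = b + a"
    by transfer (simp add: add.commute multilin_eq.refl)
  show "0 + a = a" by transfer (simp add: multilin_eq.refl)
  show "- a + a = 0" by transfer (rule multilin_eq_add_neg)
  show "a - b = a + - b" by (rule minus_ncpoly_def)
  show "a * b * c = a * (b * c)"
    by transfer (simp add: mset_times_assoc multilin_eq.refl)
  show "(a + b) * c = a * c + b * c" by transfer (simp add: multilin_eq.refl)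
  show "a * (b + c) = a * b + a * c" by transfer (simp add: multilin_eq.refl)
  show "1 * a = a" by transfer (simp add: multilin_eq.refl add: mono_times_1)
  show "a * 1 = a" by transfer (simp add: multilin_eq.refl)
qed

end

lift_definition poly_mono :: "('a, 'r::{ring,monoid_mult}) mono \<Rightarrow> ('a, 'r) ncpoly"
  is "\<lambda>m. {#m#}" .

definition homog :: "'a letter list \<Rightarrow> ('a, 'r::{ring,monoid_mult}) ncpoly \<Rightarrow> bool" where
  "homog w p \<longleftrightarrow> (\<exists>q. p = abs_ncpoly q \<and> (\<forall>m\<in>#q. word m = w))"

lemma homog_0 [simp]: "homog w 0"
  unfolding homog_def zero_ncpoly_def by (rule exI[of _ "{#}"]) auto

lemma homog_1 [simp]: "homog [] 1"
  unfolding homog_def one_ncpoly_def by (rule exI[of _ "{#1#}"]) auto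

lemma homog_mono [simp]: "word m = w \<Longrightarrow> homog w (poly_mono m)"
  unfolding homog_def by (rule exI[of _ "{#m#}"]) (auto simp: poly_mono.abs_eq)

lemma homog_add: "homog w p \<Longrightarrow> homog w q \<Longrightarrow> homog w (p + q)"
  unfolding homog_def by (metis plus_ncpoly.abs_eq union_iff)

lemma homog_uminus: "homog w p \<Longrightarrow> homog w (- p)"
  unfolding homog_def by (force simp: uminus_ncpoly.abs_eq)

lemma homog_diff: "homog w p \<Longrightarrow> homog w q \<Longrightarrow> homog w (p - q)"
  unfolding minus_ncpoly_def by (intro homog_add homog_uminus)

lemma homog_sum: "(\<And>i. i \<in> I \<Longrightarrow> homog w (f i)) \<Longrightarrow> homog w (sum f I)"
  by (induction I rule: infinite_finite_induct) (auto intro: homog_add)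

lemma homog_times:
  assumes "homog u p" "homog v q"
  shows "homog (u @ v) (p * q)"
proof -
  obtain p' q' where *: "p = abs_ncpoly p'" "\<forall>m\<in>#p'. word m = u"
    "q = abs_ncpoly q'" "\<forall>m\<in>#q'. word m = v"
    using assms unfolding homog_def by blast
  have "\<forall>m\<in>#mset_times p' q'. word m = u @ v"
    using *(2,4) by (auto simp: mset_times_def)
  then show ?thesis
    unfolding homog_def *(1,3) times_ncpoly.abs_eq by blast
qed

section \<open>Formal power series\<close>

text \<open>For each word, a series has a homogeneous component, which is a finite sum of monomials
  with that word.  The series is the formal sum of its components.\<close>

typedef (overloaded) ('a, 'r) ncseries =
  "{f :: 'a letter list \<Rightarrow> ('a, 'r::{ring,monoid_mult}) ncpoly. \<forall>w. homog w (f w)}"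
  morphisms component Abs_ncseries
  by (rule exI[of _ "\<lambda>_. 0"]) auto

setup_lifting type_definition_ncseries

lemma ncseries_eqI: "(\<And>w. component f w = component g w) \<Longrightarrow> f = g"
  by (simp add: component_inject[symmetric] fun_eq_iff)

lemma homog_component [simp]: "homog w (component f w)"
  using component[of f] by auto

instantiation ncseries :: (type, "{ring,monoid_mult}") "{ring,monoid_mult}"
begin

lift_definition zero_ncseries :: "('a, 'b) ncseries" is "\<lambda>_. 0"
  by simp

lift_definition one_ncseries :: "('a, 'b) ncseries" is "\<lambda>w. if w = [] then 1 else 0"
  by simp

lift_definition plus_ncseries :: "('a, 'b) ncseries \<Rightarrow> ('a, 'b) ncseries \<Rightarrow> ('a, 'b) ncseries"
  is "\<lambda>f g w. f w + g w"
  by (simp add: homog_add)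

lift_definition uminus_ncseries :: "('a, 'b) ncseries \<Rightarrow> ('a, 'b) ncseries"
  is "\<lambda>f w. - f w"
  by (simp add: homog_uminus)

lift_definition minus_ncseries :: "('a, 'b) ncseries \<Rightarrow> ('a, 'b) ncseries \<Rightarrow> ('a, 'b) ncseries"
  is "\<lambda>f g w. f w - g w"
  by (simp add: homog_diff)

lift_definition times_ncseries :: "('a, 'b) ncseries \<Rightarrow> ('a, 'b) ncseries \<Rightarrow> ('a, 'b) ncseries"
  is "\<lambda>f g w. \<Sum>i\<le>length w. f (take i w) * g (drop i w)"
proof (rule homog_sum)
  fix f g :: "'a letter list \<Rightarrow> ('a, 'b) ncpoly" and w :: "'a letter list" and i
  assume *: "\<And>w. homog w (f w)" "\<And>w. homog w (g w)"
  show "homog w (f (take i w) * g (drop i w))"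
    using homog_times[OF *(1)[of "take i w"] *(2)[of "drop i w"]] by simp
qed

instance
proof
  fix a b c :: "('a, 'b) ncseries"
  show "a + b + c = a + (b + c)" by transfer (simp add: add.assoc)
  show "a + b = b + a" by transfer (simp add: add.commute)
  show "0 + a = a" by transfer simp
  show "- a + a = 0" by transfer simp
  show "a - b = a + - b" by transfer simp
  show "(a + b) * c = a * c + b * c" by transfer (simp add: distrib_right sum.distrib)
  show "a * (b + c) = a * b + a * c" by transfer (simp add: distrib_left sum.distrib)
  show "1 * a = a"
  proof (transfer, rule ext)
    fix a :: "'a letter list \<Rightarrow> ('a, 'b) ncpoly" and w :: "'a letter list"
    have "(\<Sum>i\<le>length w. (if take i w = [] then 1 else 0) * a (drop i w)) =
        (\<Sum>i\<le>length w. if i = 0 then a w else 0)"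
      by (rule sum.cong) auto
    then show "(\<Sum>i\<le>length w. (if take i w = [] then 1 else 0) * a (drop i w)) = a w"
      by simp
  qed
  show "a * 1 = a"
  proof (transfer, rule ext)
    fix a :: "'a letter list \<Rightarrow> ('a, 'b) ncpoly" and w :: "'a letter list"
    have "(\<Sum>i\<le>length w. a (take i w) * (if drop i w = [] then 1 else 0)) =
        (\<Sum>i\<le>length w. if i = length w then a w else 0)"
      by (rule sum.cong) auto
    then show "(\<Sum>i\<le>length w. a (take i w) * (if drop i w = [] then 1 else 0)) = a w"
      by simp
  qed
  show "a * b * c = a * (b * c)"
  proof (transfer, rule ext)
    fix a b c :: "'a letter list \<Rightarrow> ('a, 'b) ncpoly" and w :: "'a letter list"
    let ?n = "length w"
    let ?t = "\<lambda>i j. a (take i w) * b (take (j - i) (drop i w)) * c (drop j w)"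
    have "(\<Sum>j\<le>?n. (\<Sum>i\<le>length (take j w). a (take i (take j w)) * b (drop i (take j w)))
        * c (drop j w)) = (\<Sum>j\<le>?n. \<Sum>i\<le>j. ?t i j)"
    proof (rule sum.cong)
      fix j assume "j \<in> {..?n}"
      then have "length (take j w) = j" by simp
      then show "(\<Sum>i\<le>length (take j w). a (take i (take j w)) * b (drop i (take j w)))
        * c (drop j w) = (\<Sum>i\<le>j. ?t i j)"
        unfolding sum_distrib_right by (intro sum.cong) (simp_all add: drop_take min_absorb1)
    qed simp
    also have "\<dots> = (\<Sum>i\<le>?n. \<Sum>j=i..?n. ?t i j)"
    proof -
      have "(\<Sum>(j, i)\<in>(SIGMA j:{..?n}. {..j}). ?t i j) = (\<Sum>(i, j)\<in>(SIGMA i:{..?n}. {i..?n}). ?t i j)"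
        by (rule sum.reindex_bij_witness[of _ prod.swap prod.swap]) auto
      then show ?thesis by (simp add: sum.Sigma)
    qed
    also have "\<dots> = (\<Sum>i\<le>?n. \<Sum>j\<le>?n - i. ?t i (j + i))"
    proof (rule sum.cong)
      fix i assume "i \<in> {..?n}"
      then show "(\<Sum>j=i..?n. ?t i j) = (\<Sum>j\<le>?n - i. ?t i (j + i))"
        by - (rule sum.reindex_bij_witness[of _ "\<lambda>j. j + i" "\<lambda>j. j - i"], auto)
    qed simp
    also have "\<dots> = (\<Sum>i\<le>?n. a (take i w) *
        (\<Sum>j\<le>length (drop i w). b (take j (drop i w)) * c (drop j (drop i w))))"
      by (intro sum.cong) (simp_all add: sum_distrib_left mult.assoc add.commute)
    finally show "(\<Sum>j\<le>?n. (\<Sum>i\<le>length (take j w). a (take i (take j w)) * b (drop i (take j w)))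
        * c (drop j w)) = (\<Sum>i\<le>?n. a (take i w) *
        (\<Sum>j\<le>length (drop i w). b (take j (drop i w)) * c (drop j (drop i w))))" .
  qed
qed

end

lift_definition ser_mono :: "('a, 'r::{ring,monoid_mult}) mono \<Rightarrow> ('a, 'r) ncseries"
  is "\<lambda>m w. if w = word m then poly_mono m else 0"
  by simp

definition serC :: "'r \<Rightarrow> ('a, 'r::{ring,monoid_mult}) ncseries" where
  "serC r = ser_mono (Scal r)"

definition serX :: "('a, 'r::{ring,monoid_mult}) ncseries" where
  "serX = ser_mono (Step 1 LX (Scal 1))"

definition serY :: "'a \<Rightarrow> ('a, 'r::{ring,monoid_mult}) ncseries" where
  "serY \<alpha> = ser_mono (Step 1 (LY \<alpha>) (Scal 1))"

text \<open>Every monomial of \<open>f\<close> has degree at least \<open>n\<close> in \<open>X\<close>.\<close>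

definition xdeg_ge :: "nat \<Rightarrow> ('a, 'r::{ring,monoid_mult}) ncseries \<Rightarrow> bool" where
  "xdeg_ge n f \<longleftrightarrow> (\<forall>w. component f w \<noteq> 0 \<longrightarrow> n \<le> count_list w LX)"

text \<open>The formal sum of a possibly infinite family of series.  It is meaningful if for each word
  only finitely many members have a nonzero component; other words get the component \<open>0\<close>.\<close>

lift_definition fsum :: "'i set \<Rightarrow> ('i \<Rightarrow> ('a, 'r::{ring,monoid_mult}) ncseries) \<Rightarrow> ('a, 'r) ncseries"
  is "\<lambda>I f w. \<Sum>i\<in>{i\<in>I. f i w \<noteq> 0}. f i w"
  by (rule homog_sum) auto

section \<open>Composition in \<open>X\<close>\<close>

primrec mono_subst :: "('a, 'r::{ring,monoid_mult}) ncseries \<Rightarrow> ('a, 'r) mono \<Rightarrow> ('a, 'r) ncseries"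
where
  "mono_subst h (Scal r) = serC r"
| "mono_subst h (Step r Z m) =
     serC r * (case Z of LX \<Rightarrow> h | LY \<alpha> \<Rightarrow> serY \<alpha>) * mono_subst h m"

lemma poly_mono_Scal_add: "poly_mono (Scal (r + s)) = poly_mono (Scal r) + poly_mono (Scal s)"
  using multilin_eq.split[of 1 r s 1]
  by (simp add: poly_mono.abs_eq plus_ncpoly.abs_eq ncpoly.abs_eq_iff one_mono_def add_mset_commute)

lemma poly_mono_Scal_0: "poly_mono (Scal 0) = 0"
  using multilin_eq.zero[of 1 1]
  by (simp add: poly_mono.abs_eq zero_ncpoly_def ncpoly.abs_eq_iff one_mono_def)

lemma poly_mono_times: "poly_mono (m * n) = poly_mono m * poly_mono n"
  by transfer (simp add: multilin_eq.refl)

lemma serC_add: "serC (r + s) = serC r + serC s"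
  unfolding serC_def by (rule ncseries_eqI, transfer) (simp add: poly_mono_Scal_add)

lemma serC_0: "serC 0 = 0"
  unfolding serC_def by (rule ncseries_eqI, transfer) (simp add: poly_mono_Scal_0)

lemma serC_times: "serC (r * s) = serC r * serC s"
  unfolding serC_def
proof (rule ncseries_eqI, transfer)
  fix r s :: 'b and w :: "'a letter list"
  show "(if w = word (Scal (r * s)) then poly_mono (Scal (r * s) :: ('a, 'b) mono) else 0) =
      (\<Sum>i\<le>length w. (if take i w = word (Scal r) then poly_mono (Scal r) else 0) *
      (if drop i w = word (Scal s) then poly_mono (Scal s) else 0))"
    using poly_mono_times[of "Scal r :: ('a, 'b) mono" "Scal s"]
    by (cases w) (auto intro!: sum.neutral[symmetric])
qed

lemma mono_subst_times: "mono_subst h (m * n) = mono_subst h m * mono_subst h n"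
proof (induction m)
  case (Scal r)
  then show ?case by (cases n) (auto simp: serC_times mult.assoc)
qed (auto simp: mult.assoc)

lift_definition poly_subst :: "('a, 'r::{ring,monoid_mult}) ncseries \<Rightarrow> ('a, 'r) ncpoly
    \<Rightarrow> ('a, 'r) ncseries"
  is "\<lambda>h p. \<Sum>m\<in>#p. mono_subst h m"
proof -
  fix h :: "('a, 'r) ncseries" and p q :: "('a, 'r) mono multiset"
  assume "multilin_eq p q"
  then show "(\<Sum>m\<in>#p. mono_subst h m) = (\<Sum>m\<in>#q. mono_subst h m)"
    by induction (auto simp: mono_subst_times serC_add serC_0 distrib_left distrib_right)
qed

text \<open>Meaningful if every monomial of \<open>h\<close> has degree at least 1 in \<open>X\<close>; then for each word only
  finitely many members of the family contribute.\<close>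

definition xcompose :: "('a, 'r::{ring,monoid_mult}) ncseries \<Rightarrow> ('a, 'r) ncseries
    \<Rightarrow> ('a, 'r) ncseries"  (infixl "\<circ>\<^sub>X" 75)
  where "f \<circ>\<^sub>X h = fsum UNIV (\<lambda>w. poly_subst h (component f w))"

section \<open>Matrix times vector\<close>

definition mat_vec :: "'a set \<Rightarrow> ('a \<Rightarrow> 'a \<Rightarrow> 'r::{ring,monoid_mult}) \<Rightarrow> ('a \<Rightarrow> ('a, 'r) ncseries)
    \<Rightarrow> 'a \<Rightarrow> ('a, 'r) ncseries" where
  "mat_vec A M V \<alpha> = fsum A (\<lambda>\<beta>. serC (M \<alpha> \<beta>) * V \<beta>)"

end

theory Submission
  imports Defs
begin

text \<open>
  Applying \<open>\<circ>\<^sub>X gt\<close> to the equations for \<open>V\<close> shows that \<open>V \<alpha> \<circ>\<^sub>X gt\<close> solves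
  \<open>Z \<alpha> = Y\<^sub>\<alpha> (gt - (M\<^sub>1 Z)\<^sub>\<alpha>) \<dots> (gt - (M\<^sub>k Z)\<^sub>\<alpha>)\<close>.  Since \<open>gt = -X + \<Sum>\<^sub>\<beta> Vt \<beta>\<close> and
  \<open>Mt\<^sub>j = J - M\<^sub>j\<close>, the family \<open>Vt\<close> solves the same system.  The leading factor \<open>Y\<^sub>\<alpha>\<close> makes the
  right-hand side a contraction with respect to word length, so the solution is unique and
  \<open>V \<alpha> \<circ>\<^sub>X gt = Vt \<alpha>\<close>.  Hence \<open>g \<circ>\<^sub>X gt = -gt + \<Sum>\<^sub>\<alpha> Vt \<alpha> = X\<close>; the other composition is symmetric.
\<close>

section \<open>Components\<close>

lemma component_simps [simp]:
  "component 0 w = 0"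
  "component (f + g) w = component f w + component g w"
  "component (- f) w = - component f w"
  "component (f - g) w = component f w - component g w"
  by (simp_all add: zero_ncseries.rep_eq plus_ncseries.rep_eq uminus_ncseries.rep_eq
      minus_ncseries.rep_eq)

lemma component_times:
  "component (f * g) w = (\<Sum>i\<le>length w. component f (take i w) * component g (drop i w))"
  by (simp add: times_ncseries.rep_eq)

lemma component_sum: "component (sum f I) w = (\<Sum>i\<in>I. component (f i) w)"
  by (induction I rule: infinite_finite_induct) auto

lemma component_times_nonzeroE:
  assumes "component (f * g) w \<noteq> 0"
  obtains u v where "w = u @ v" "component f u \<noteq> 0" "component g v \<noteq> 0"
proof -
  obtain i where "component f (take i w) * component g (drop i w) \<noteq> 0"
    using assms unfolding component_times by (meson sum.neutral)
  then show thesis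
    by (intro that[of "take i w" "drop i w"]) auto
qed

lemma component_ser_mono:
  "component (ser_mono m) w = (if w = word m then poly_mono m else 0)"
  by (simp add: ser_mono.rep_eq)

text \<open>In the Cauchy product only the cut after \<open>length (word m)\<close> letters can pair
  a prefix of \<open>w\<close> with \<open>word m\<close>.\<close>

lemma component_ser_mono_times:
  "component (ser_mono m * f) w =
    (if take (length (word m)) w = word m
     then poly_mono m * component f (drop (length (word m)) w) else 0)"
proof -
  let ?n = "length (word m)"
  have *: "take i w = word m \<longleftrightarrow> i = ?n \<and> take ?n w = word m" if "i \<le> length w" for i
    using that by (metis length_take min.absorb2)
  have "component (ser_mono m * f) w =
      (\<Sum>i\<le>length w. if i = ?n then if take ?n w = word m
        then poly_mono m * component f (drop ?n w) else 0 else 0)"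
    unfolding component_times proof (rule sum.cong)
    fix i assume "i \<in> {..length w}"
    then show "component (ser_mono m) (take i w) * component f (drop i w) =
        (if i = ?n then if take ?n w = word m then poly_mono m * component f (drop ?n w) else 0 else 0)"
      by (simp only: component_ser_mono * atMost_iff eq_commute[of "take i w"]) simp
  qed simp
  also have "\<dots> = (if take ?n w = word m then poly_mono m * component f (drop ?n w) else 0)"
    by (auto dest: arg_cong[of _ _ length])
  finally show ?thesis .
qed

lemma component_serC_times: "component (serC r * f) w = poly_mono (Scal r) * component f w"
  by (simp add: serC_def component_ser_mono_times)

lemma component_serY_times:
  "component (serY a * f) w =
    (case w of LY b # v \<Rightarrow> if a = b then poly_mono (Step 1 (LY a) (Scal 1)) * component f v else 0
     | _ \<Rightarrow> 0)"
  by (auto simp: serY_def component_ser_mono_times split: list.split letter.split)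

lemma ser_mono_1: "ser_mono 1 = 1"
proof (rule ncseries_eqI)
  fix w :: "'a letter list"
  have "poly_mono 1 = (1 :: ('a, 'b) ncpoly)"
    by transfer (rule multilin_eq.refl)
  then show "component (ser_mono 1) w = component (1 :: ('a, 'b) ncseries) w"
    by (cases w) (simp_all add: component_ser_mono one_ncseries.rep_eq)
qed

section \<open>Formal sums\<close>

text \<open>The condition under which \<open>fsum\<close> is a genuine formal sum: where it fails at
  a word, \<open>fsum\<close> takes the default value \<open>0\<close> there, and additivity may
  break down.\<close>

definition locally_finite :: "'i set \<Rightarrow> ('i \<Rightarrow> ('a, 'r::{ring,monoid_mult}) ncseries) \<Rightarrow> bool" where
  "locally_finite I f \<longleftrightarrow> (\<forall>w. finite {i \<in> I. component (f i) w \<noteq> 0})"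

lemma component_fsum: "component (fsum I f) w = (\<Sum>i\<in>{i\<in>I. component (f i) w \<noteq> 0}. component (f i) w)"
  by (simp add: fsum.rep_eq)

lemma component_fsum_finite:
  assumes "finite J" "J \<subseteq> I" "\<And>i. i \<in> I - J \<Longrightarrow> component (f i) w = 0"
  shows "component (fsum I f) w = (\<Sum>i\<in>J. component (f i) w)"
  unfolding component_fsum by (rule sum.mono_neutral_left) (use assms in auto)

lemma fsum_cong: "(\<And>i. i \<in> I \<Longrightarrow> f i = g i) \<Longrightarrow> fsum I f = fsum I g"
  by (rule ncseries_eqI) (auto simp: component_fsum intro!: sum.cong)

lemma locally_finite_serC_times:
  "locally_finite I f \<Longrightarrow> locally_finite I (\<lambda>i. serC (c i) * f i)"
  unfolding locally_finite_def component_serC_times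
proof
  fix w
  assume "\<forall>w. finite {i \<in> I. component (f i) w \<noteq> 0}"
  then show "finite {i \<in> I. poly_mono (Scal (c i)) * component (f i) w \<noteq> 0}"
    by (rule allE[of _ w]) (rule finite_subset[rotated], auto)
qed

text \<open>The three supports at a word may differ because of cancellation, so all three sums are
  taken over one finite set \<open>?J\<close> containing them.\<close>

lemma fsum_diff:
  assumes "locally_finite I f" "locally_finite I g"
  shows "fsum I (\<lambda>i. f i - g i) = fsum I f - fsum I g"
proof (rule ncseries_eqI)
  fix w
  let ?J = "{i \<in> I. component (f i) w \<noteq> 0} \<union> {i \<in> I. component (g i) w \<noteq> 0}"
  have "finite ?J" using assms by (simp add: locally_finite_def)
  then have "component (fsum I h) w = (\<Sum>i\<in>?J. component (h i) w)"
    if "h \<in> {f, g, \<lambda>i. f i - g i}" for h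
    using that by (intro component_fsum_finite) auto
  then show "component (fsum I (\<lambda>i. f i - g i)) w = component (fsum I f - fsum I g) w"
    by (simp add: sum_subtractf)
qed

lemma serC_1: "serC 1 = 1"
  by (simp add: serC_def ser_mono_1[unfolded one_mono_def])

lemma mat_vec_complement:
  assumes "locally_finite A V"
  shows "mat_vec A (\<lambda>\<alpha> \<beta>. 1 - M \<alpha> \<beta>) V \<alpha> = fsum A V - mat_vec A M V \<alpha>"
proof -
  have *: "serC (1 - r) = 1 - serC r" for r :: 'b
    using serC_add[of "1 - r" r] by (simp add: serC_1 eq_diff_eq)
  have "mat_vec A (\<lambda>\<alpha> \<beta>. 1 - M \<alpha> \<beta>) V \<alpha> = fsum A (\<lambda>\<beta>. V \<beta> - serC (M \<alpha> \<beta>) * V \<beta>)"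
    by (simp add: mat_vec_def * left_diff_distrib)
  also have "\<dots> = fsum A V - mat_vec A M V \<alpha>"
    unfolding mat_vec_def by (intro fsum_diff assms locally_finite_serC_times)
  finally show ?thesis .
qed

lemma serC_uminus: "serC (- r) = - serC r"
  using serC_add[of "- r" r] by (simp add: serC_0 eq_neg_iff_add_eq_0)

text \<open>Serves to write \<open>serX - mat_vec A M V \<alpha>\<close> as a sum, so that both
  systems get factors of the one form \<open>p + mat_vec A N V \<alpha>\<close>.\<close>

lemma mat_vec_uminus: "mat_vec A (\<lambda>\<alpha> \<beta>. - M \<alpha> \<beta>) V \<alpha> = - mat_vec A M V \<alpha>"
  unfolding mat_vec_def
  by (rule ncseries_eqI) (simp add: serC_uminus component_fsum sum_negf)

section \<open>Substitution into polynomials\<close>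

lemma poly_subst_0 [simp]: "poly_subst h 0 = 0"
  by transfer simp

lemma poly_subst_add: "poly_subst h (p + q) = poly_subst h p + poly_subst h q"
  by transfer simp

lemma poly_subst_uminus: "poly_subst h (- p) = - poly_subst h p"
  using poly_subst_add[of h "- p" p] by (simp add: eq_neg_iff_add_eq_0)

lemma poly_subst_sum: "poly_subst h (sum f I) = (\<Sum>i\<in>I. poly_subst h (f i))"
  by (induction I rule: infinite_finite_induct) (auto simp: poly_subst_add)

lemma poly_subst_mono: "poly_subst h (poly_mono m) = mono_subst h m"
  by transfer simp

lemma poly_subst_times: "poly_subst h (p * q) = poly_subst h p * poly_subst h q"
proof transfer
  fix h :: "('a, 'b) ncseries" and p q :: "('a, 'b) mono multiset"
  have *: "(\<Sum>n\<in>#image_mset ((*) m) q. mono_subst h n) = mono_subst h m * (\<Sum>n\<in>#q. mono_subst h n)" for m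
    by (induction q) (auto simp: mono_subst_times distrib_left)
  show "(\<Sum>m\<in>#mset_times p q. mono_subst h m) =
      (\<Sum>m\<in>#p. mono_subst h m) * (\<Sum>m\<in>#q. mono_subst h m)"
    by (induction p) (auto simp: * distrib_right)
qed

text \<open>If \<open>h\<close> has no constant term, these words \<open>w\<close> are the only ones whose substitution can
  contribute to the component at \<open>v\<close>: each letter of \<open>w\<close> produces at least one letter of \<open>v\<close>.\<close>

definition source_words :: "'a letter list \<Rightarrow> 'a letter list set" where
  "source_words v = {w. set w \<subseteq> insert LX (set v) \<and> length w \<le> length v}"

lemma finite_source_words [simp]: "finite (source_words v)"
  unfolding source_words_def by (rule finite_lists_length_le) simp

lemma source_words_append:
  "u \<in> source_words v \<Longrightarrow> u' \<in> source_words v' \<Longrightarrow> u @ u' \<in> source_words (v @ v')"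
  by (auto simp: source_words_def)

lemma source_words_appendD: "u @ u' \<in> source_words v \<Longrightarrow> u \<in> source_words v \<and> u' \<in> source_words v"
  by (auto simp: source_words_def)

text \<open>Induction along the monomial: each letter is replaced by a series without constant term,
  \<open>h\<close> or a single variable, so it uses up a nonempty piece of \<open>v\<close>; a
  letter \<open>LY \<alpha>\<close> must itself occur in that piece.\<close>

lemma component_mono_subst_nonzero:
  assumes "component h [] = 0" "component (mono_subst h m) v \<noteq> 0"
  shows "word m \<in> source_words v"
  using assms(2)
proof (induction m arbitrary: v)
  case (Scal r)
  then show ?case by (simp add: source_words_def)
next
  case (Step r Z m)
  let ?L = "case Z of LX \<Rightarrow> h | LY \<alpha> \<Rightarrow> serY \<alpha>"
  obtain u u' where v: "v = u @ u'" "component (serC r * ?L) u \<noteq> 0" "component (mono_subst h m) u' \<noteq> 0"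
    using Step.prems by (auto elim: component_times_nonzeroE)
  have "component ?L u \<noteq> 0"
    using v(2) by (auto simp: component_serC_times)
  then have "[Z] \<in> source_words u"
    using assms(1)
    by (cases u) (auto simp: source_words_def serY_def component_ser_mono split: letter.splits if_splits)
  from source_words_append[OF this Step.IH[OF v(3)]] show ?case
    by (simp add: v(1))
qed

lemma component_poly_subst_nonzero:
  assumes "component h [] = 0" "homog w p" "component (poly_subst h p) v \<noteq> 0"
  shows "w \<in> source_words v"
proof -
  \<comment> \<open>Other representatives of \<open>p\<close> may contain monomials with other
    words; homogeneity supplies one that does not.\<close>
  obtain q where q: "p = abs_ncpoly q" "\<forall>m\<in>#q. word m = w"
    using assms(2) unfolding homog_def by blast
  have "\<exists>m\<in>#q. component (mono_subst h m) v \<noteq> 0"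
    using assms(3) unfolding q(1) poly_subst.abs_eq by (induction q) auto
  then show ?thesis
    using component_mono_subst_nonzero[OF assms(1)] q(2) by metis
qed

section \<open>Composition is a homomorphism\<close>

text \<open>The index set is finite and depends on \<open>v\<close> only, not on \<open>f\<close>,
  so identities for \<open>poly_subst\<close> carry over to composition by finite summation.\<close>

lemma component_xcompose:
  assumes "component h [] = 0"
  shows "component (f \<circ>\<^sub>X h) v = (\<Sum>w\<in>source_words v. component (poly_subst h (component f w)) v)"
  unfolding xcompose_def
  by (rule component_fsum_finite) (use component_poly_subst_nonzero[OF assms homog_component] in auto)

lemma xcompose_ser_mono: "ser_mono m \<circ>\<^sub>X h = mono_subst h m"
proof (rule ncseries_eqI)
  fix v
  have "component (ser_mono m \<circ>\<^sub>X h) v =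
      (\<Sum>w\<in>{word m}. component (poly_subst h (component (ser_mono m) w)) v)"
    unfolding xcompose_def by (rule component_fsum_finite) (auto simp: component_ser_mono)
  then show "component (ser_mono m \<circ>\<^sub>X h) v = component (mono_subst h m) v"
    by (simp add: component_ser_mono poly_subst_mono)
qed

lemma xcompose_serC: "serC r \<circ>\<^sub>X h = serC r"
  by (simp add: serC_def xcompose_ser_mono)

lemma xcompose_1: "1 \<circ>\<^sub>X h = 1"
  using xcompose_serC[of 1 h] by (simp add: serC_1)

lemma xcompose_serX: "serX \<circ>\<^sub>X h = h"
  by (simp add: serX_def xcompose_ser_mono serC_1)

lemma xcompose_serY: "serY a \<circ>\<^sub>X h = serY a"
  unfolding serY_def[of a] xcompose_ser_mono by (simp add: serC_1) (simp add: serY_def)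

lemma xcompose_add:
  "component h [] = 0 \<Longrightarrow> (f + f') \<circ>\<^sub>X h = f \<circ>\<^sub>X h + f' \<circ>\<^sub>X h"
  by (rule ncseries_eqI) (simp add: component_xcompose poly_subst_add sum.distrib)

lemma xcompose_uminus:
  "component h [] = 0 \<Longrightarrow> (- f) \<circ>\<^sub>X h = - (f \<circ>\<^sub>X h)"
  by (rule ncseries_eqI) (simp add: component_xcompose poly_subst_uminus sum_negf)

text \<open>Cutting the substituted word \<open>w\<close> into \<open>u\<close> and
  \<open>u'\<close> is independent of cutting the result \<open>v\<close> at \<open>j\<close>.
  Exchanging the two summations turns the left-hand side into the Cauchy product.\<close>

lemma xcompose_times:
  assumes h: "component h [] = 0"
  shows "(f * f') \<circ>\<^sub>X h = (f \<circ>\<^sub>X h) * (f' \<circ>\<^sub>X h)"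
proof (rule ncseries_eqI)
  fix v :: "'a letter list"
  let ?S = "source_words v"
  define F where "F u j = component (poly_subst h (component f u)) (take j v)" for u j
  define F' where "F' u j = component (poly_subst h (component f' u)) (drop j v)" for u j
  \<comment> \<open>\<open>T (u, u')\<close> is the total contribution of the pair to the component
    at \<open>v\<close>, over all cuts of \<open>v\<close>.\<close>
  define T where "T = (\<lambda>(u, u'). \<Sum>j\<le>length v. F u j * F' u' j)"
  have S_take: "source_words (take j v) \<subseteq> ?S" and S_drop: "source_words (drop j v) \<subseteq> ?S" for j
    by (auto simp: source_words_def dest: in_set_takeD in_set_dropD)
  have F0: "u \<in> source_words (take j v)" if "F u j \<noteq> 0" for u j
    using that component_poly_subst_nonzero[OF h homog_component] unfolding F_def by blast
  have F'0: "u \<in> source_words (drop j v)" if "F' u j \<noteq> 0" for u j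
    using that component_poly_subst_nonzero[OF h homog_component] unfolding F'_def by blast
  have T0: "u @ u' \<in> ?S" if "T (u, u') \<noteq> 0" for u u'
  proof (rule ccontr)
    assume notin: "u @ u' \<notin> ?S"
    have "F u j * F' u' j = 0" for j
    proof (rule ccontr)
      assume "F u j * F' u' j \<noteq> 0"
      then have "F u j \<noteq> 0" "F' u' j \<noteq> 0" by auto
      then have "u @ u' \<in> source_words (take j v @ drop j v)"
        by (intro source_words_append F0 F'0)
      then show False using notin by simp
    qed
    then show False using that by (simp add: T_def)
  qed
  have "component ((f * f') \<circ>\<^sub>X h) v = (\<Sum>w\<in>?S. \<Sum>i\<le>length w. T (take i w, drop i w))"
    unfolding component_xcompose[OF h] T_def F_def F'_def
    by (simp add: component_times poly_subst_sum poly_subst_times component_sum)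
  also have "\<dots> = (\<Sum>(w, i)\<in>(SIGMA w:?S. {..length w}). T (take i w, drop i w))"
    by (simp add: sum.Sigma)
  \<comment> \<open>A word with a cut position is the same as a pair of words.\<close>
  also have "\<dots> = (\<Sum>(u, u')\<in>{(u, u'). u @ u' \<in> ?S}. T (u, u'))"
    by (rule sum.reindex_bij_witness[of _ "\<lambda>(u, u'). (u @ u', length u)" "\<lambda>(w, i). (take i w, drop i w)"])
      auto
  \<comment> \<open>Enlarging the index set to a rectangle adds only zero terms and lets the sum
    factor.\<close>
  also have "\<dots> = (\<Sum>(u, u')\<in>?S \<times> ?S. T (u, u'))"
    by (rule sum.mono_neutral_left) (auto dest: T0 source_words_appendD)
  also have "\<dots> = (\<Sum>j\<le>length v. \<Sum>(u, u')\<in>?S \<times> ?S. F u j * F' u' j)"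
    unfolding T_def by (simp add: case_prod_unfold) (rule sum.swap)
  also have "\<dots> = (\<Sum>j\<le>length v. (\<Sum>u\<in>?S. F u j) * (\<Sum>u'\<in>?S. F' u' j))"
    by (simp add: sum_product sum.cartesian_product)
  also have "\<dots> = (\<Sum>j\<le>length v. component (f \<circ>\<^sub>X h) (take j v) * component (f' \<circ>\<^sub>X h) (drop j v))"
  proof (intro sum.cong arg_cong2[where f = "(*)"] HOL.refl)
    fix j
    show "(\<Sum>u\<in>?S. F u j) = component (f \<circ>\<^sub>X h) (take j v)"
      unfolding component_xcompose[OF h]
      by (rule sum.mono_neutral_cong_right) (use S_take F0 in \<open>auto simp: F_def\<close>)
    show "(\<Sum>u\<in>?S. F' u j) = component (f' \<circ>\<^sub>X h) (drop j v)"
      unfolding component_xcompose[OF h]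
      by (rule sum.mono_neutral_cong_right) (use S_drop F'0 in \<open>auto simp: F'_def\<close>)
  qed
  finally show "component ((f * f') \<circ>\<^sub>X h) v = component ((f \<circ>\<^sub>X h) * (f' \<circ>\<^sub>X h)) v"
    by (simp add: component_times)
qed

lemma xcompose_prod_list:
  "component h [] = 0 \<Longrightarrow> (\<Prod>j\<leftarrow>js. f j) \<circ>\<^sub>X h = (\<Prod>j\<leftarrow>js. f j \<circ>\<^sub>X h)"
  by (induction js) (auto simp: xcompose_1 xcompose_times)

lemma xcompose_fsum:
  assumes h: "component h [] = 0" and f: "locally_finite I f"
  shows "fsum I f \<circ>\<^sub>X h = fsum I (\<lambda>i. f i \<circ>\<^sub>X h)"
proof (rule ncseries_eqI)
  fix v :: "'a letter list"
  \<comment> \<open>Only finitely many words matter at \<open>v\<close>, and each meets finitely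
    many members of the family; \<open>J\<close> collects these indices.\<close>
  define J where "J = (\<Union>w\<in>source_words v. {i \<in> I. component (f i) w \<noteq> 0})"
  have J: "finite J" "J \<subseteq> I"
    using f by (auto simp: J_def locally_finite_def)
  have f0: "component (f i) w = 0" if "w \<in> source_words v" "i \<in> I - J" for i w
    using that by (auto simp: J_def)
  have "component (fsum I f \<circ>\<^sub>X h) v =
      (\<Sum>w\<in>source_words v. component (poly_subst h (\<Sum>i\<in>J. component (f i) w)) v)"
    unfolding component_xcompose[OF h]
    by (rule sum.cong) (auto simp: component_fsum_finite[OF J f0, simplified])
  also have "\<dots> = (\<Sum>i\<in>J. component (f i \<circ>\<^sub>X h) v)"
    unfolding component_xcompose[OF h] poly_subst_sum component_sum by (rule sum.swap)
  also have "\<dots> = component (fsum I (\<lambda>i. f i \<circ>\<^sub>X h)) v"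
    by (rule component_fsum_finite[symmetric]) (use J f0 in \<open>auto simp: component_xcompose[OF h]\<close>)
  finally show "component (fsum I f \<circ>\<^sub>X h) v = component (fsum I (\<lambda>i. f i \<circ>\<^sub>X h)) v" .
qed

lemma xcompose_mat_vec:
  assumes "component h [] = 0" "locally_finite A V"
  shows "mat_vec A M V \<alpha> \<circ>\<^sub>X h = mat_vec A M (\<lambda>\<beta>. V \<beta> \<circ>\<^sub>X h) \<alpha>"
  using assms unfolding mat_vec_def
  by (simp add: xcompose_fsum locally_finite_serC_times xcompose_times xcompose_serC)

section \<open>Uniqueness of the solution\<close>

text \<open>Congruence modulo series all of whose words have length at least
  \<open>n\<close>.\<close>

definition agree :: "nat \<Rightarrow> ('a, 'r::{ring,monoid_mult}) ncseries \<Rightarrow> ('a, 'r) ncseries \<Rightarrow> bool" where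
  "agree n f g \<longleftrightarrow> (\<forall>w. length w < n \<longrightarrow> component f w = component g w)"

lemma agree_refl: "agree n f f"
  by (simp add: agree_def)

lemma agree_add: "agree n f g \<Longrightarrow> agree n f' g' \<Longrightarrow> agree n (f + f') (g + g')"
  by (simp add: agree_def)

lemma agree_times: "agree n f g \<Longrightarrow> agree n f' g' \<Longrightarrow> agree n (f * f') (g * g')"
  unfolding agree_def component_times by (auto intro!: sum.cong)

lemma agree_prod_list:
  "(\<And>j. j \<in> set js \<Longrightarrow> agree n (f j) (g j)) \<Longrightarrow> agree n (\<Prod>j\<leftarrow>js. f j) (\<Prod>j\<leftarrow>js. g j)"
  by (induction js) (auto intro: agree_times agree_refl)

lemma agree_fsum: "(\<And>i. i \<in> I \<Longrightarrow> agree n (f i) (g i)) \<Longrightarrow> agree n (fsum I f) (fsum I g)"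
  unfolding agree_def component_fsum by (auto intro!: sum.cong)

lemma agree_mat_vec:
  "(\<And>\<beta>. \<beta> \<in> A \<Longrightarrow> agree n (V \<beta>) (W \<beta>)) \<Longrightarrow> agree n (mat_vec A M V \<alpha>) (mat_vec A M W \<alpha>)"
  unfolding mat_vec_def by (intro agree_fsum agree_times agree_refl)

lemma agree_serY_times: "agree n f g \<Longrightarrow> agree (Suc n) (serY a * f) (serY a * g)"
  by (auto simp: agree_def component_serY_times split: list.split letter.split)

text \<open>Agreement below length \<open>n\<close>, for all indices in \<open>A\<close> at once
  since the equations are coupled, passes through sums and products, and the leading variable raises
  it to \<open>Suc n\<close>. The parameters \<open>p\<close> and \<open>N\<close> cover both
  systems.\<close>

lemma fixed_point_unique:
  assumes V: "\<And>\<alpha>. \<alpha> \<in> A \<Longrightarrow> V \<alpha> = serY \<alpha> * (\<Prod>j\<leftarrow>js. p + mat_vec A (N j) V \<alpha>)"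
    and W: "\<And>\<alpha>. \<alpha> \<in> A \<Longrightarrow> W \<alpha> = serY \<alpha> * (\<Prod>j\<leftarrow>js. p + mat_vec A (N j) W \<alpha>)"
    and "\<alpha> \<in> A"
  shows "V \<alpha> = W \<alpha>"
proof -
  have "agree n (V \<alpha>) (W \<alpha>)" if "\<alpha> \<in> A" for n \<alpha>
    using that
  proof (induction n arbitrary: \<alpha>)
    case 0
    show ?case by (simp add: agree_def)
  next
    case (Suc n)
    show ?case
      unfolding V[OF Suc.prems] W[OF Suc.prems]
      by (intro agree_serY_times agree_prod_list agree_add agree_refl agree_mat_vec Suc.IH)
  qed
  then show ?thesis
    using \<open>\<alpha> \<in> A\<close> by (intro ncseries_eqI) (auto simp: agree_def)
qed

section \<open>Composition applied to a solution of the system\<close>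

lemma locally_finite_serY_times:
  assumes "\<And>\<alpha>. \<alpha> \<in> A \<Longrightarrow> V \<alpha> = serY \<alpha> * f \<alpha>"
  shows "locally_finite A V"
  unfolding locally_finite_def
proof
  fix w
  \<comment> \<open>The leading variable determines the index, so at most one member contributes at
    \<open>w\<close>. For \<open>w = []\<close> the left-hand set is empty, whatever
    \<open>hd []\<close> is.\<close>
  have "{\<alpha> \<in> A. component (V \<alpha>) w \<noteq> 0} \<subseteq> {\<alpha>. hd w = LY \<alpha>}"
    by (auto simp: assms component_serY_times split: list.splits letter.splits if_splits)
  moreover have "finite {\<alpha>. hd w = LY \<alpha>}"
    by (cases "hd w") auto
  ultimately show "finite {\<alpha> \<in> A. component (V \<alpha>) w \<noteq> 0}"
    by (rule finite_subset)
qed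

lemma component_Nil_fsum_serY_times:
  assumes "\<And>\<alpha>. \<alpha> \<in> A \<Longrightarrow> V \<alpha> = serY \<alpha> * f \<alpha>"
  shows "component (- serX + fsum A V) [] = 0"
  by (simp add: serX_def component_ser_mono component_fsum assms component_serY_times)

text \<open>Composition with \<open>h\<close> is a homomorphism fixing coefficients and each
  \<open>serY \<alpha>\<close>, so it maps the system for \<open>V\<close> to the one for
  \<open>W\<close>, with \<open>p\<close> replaced by its composite; uniqueness identifies the
  solutions.\<close>

lemma xcompose_solution:
  assumes h: "component h [] = 0"
    and V: "\<And>\<alpha>. \<alpha> \<in> A \<Longrightarrow> V \<alpha> = serY \<alpha> * (\<Prod>j\<leftarrow>js. p + mat_vec A (N j) V \<alpha>)"
    and W: "\<And>\<alpha>. \<alpha> \<in> A \<Longrightarrow> W \<alpha> = serY \<alpha> * (\<Prod>j\<leftarrow>js. p \<circ>\<^sub>X h + mat_vec A (N j) W \<alpha>)"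
  shows "(- serX + fsum A V) \<circ>\<^sub>X h = - h + fsum A W"
proof -
  have fin: "locally_finite A V"
    using V by (rule locally_finite_serY_times)
  have "V \<alpha> \<circ>\<^sub>X h = serY \<alpha> * (\<Prod>j\<leftarrow>js. p \<circ>\<^sub>X h + mat_vec A (N j) (\<lambda>\<beta>. V \<beta> \<circ>\<^sub>X h) \<alpha>)"
    if "\<alpha> \<in> A" for \<alpha>
    by (subst V[OF that])
      (simp add: h fin xcompose_times xcompose_serY xcompose_prod_list xcompose_add xcompose_mat_vec)
  then have "V \<alpha> \<circ>\<^sub>X h = W \<alpha>" if "\<alpha> \<in> A" for \<alpha>
    using W that by (rule fixed_point_unique)
  then have "fsum A (\<lambda>\<alpha>. V \<alpha> \<circ>\<^sub>X h) = fsum A W"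
    by (rule fsum_cong)
  then show ?thesis
    by (simp only: h fin xcompose_add xcompose_uminus xcompose_serX xcompose_fsum)
qed

theorem theorem2p1:
  fixes A :: "'a set"
    and k :: nat
    and M Mt :: "nat \<Rightarrow> 'a \<Rightarrow> 'a \<Rightarrow> 'r::{ring,monoid_mult}"
    and V Vt :: "'a \<Rightarrow> ('a, 'r) ncseries"
    and g gt :: "('a, 'r) ncseries"
  assumes "k \<ge> 2"
    and "\<And>\<alpha>. \<alpha> \<in> A \<Longrightarrow> xdeg_ge (k + 1) (V \<alpha> - serY \<alpha> * serX ^ k)"
    and "\<And>\<alpha>. \<alpha> \<in> A \<Longrightarrow> V \<alpha> = serY \<alpha> * (\<Prod>j\<leftarrow>[1..<k+1]. serX - mat_vec A (M j) V \<alpha>)"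
    and "\<And>j \<alpha> \<beta>. Mt j \<alpha> \<beta> = 1 - M j \<alpha> \<beta>"
    and "\<And>\<alpha>. \<alpha> \<in> A \<Longrightarrow> xdeg_ge (k + 1) (Vt \<alpha> - serY \<alpha> * (- serX) ^ k)"
    and "\<And>\<alpha>. \<alpha> \<in> A \<Longrightarrow>
           Vt \<alpha> = serY \<alpha> * (\<Prod>j\<leftarrow>[1..<k+1]. - serX + mat_vec A (Mt j) Vt \<alpha>)"
    and "g = - serX + fsum A V"
    and "gt = - serX + fsum A Vt"
  shows "g \<circ>\<^sub>X gt = serX \<and> gt \<circ>\<^sub>X g = serX"
proof -
  note V = assms(3) and Vt = assms(6) and g = assms(7) and gt = assms(8)
  have Mt: "mat_vec A (Mt j) W \<alpha> = fsum A W - mat_vec A (M j) W \<alpha>" if "locally_finite A W" for j W \<alpha>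
    using mat_vec_complement[OF that, of "M j" \<alpha>] by (simp add: assms(4)[abs_def] mat_vec_def)
  have V_fin: "locally_finite A V" using V by (rule locally_finite_serY_times)
  have Vt_fin: "locally_finite A Vt" using Vt by (rule locally_finite_serY_times)
  have g0: "component g [] = 0" unfolding g using V by (rule component_Nil_fsum_serY_times)
  have gt0: "component gt [] = 0" unfolding gt using Vt by (rule component_Nil_fsum_serY_times)
  have "g \<circ>\<^sub>X gt = - gt + fsum A Vt"
    unfolding g
  proof (rule xcompose_solution[OF gt0, where js = "[1..<k+1]" and p = serX
        and N = "\<lambda>j \<alpha> \<beta>. - M j \<alpha> \<beta>"])
    fix \<alpha> assume "\<alpha> \<in> A"
    from V[OF this] show "V \<alpha> = serY \<alpha> *
        (\<Prod>j\<leftarrow>[1..<k+1]. serX + mat_vec A (\<lambda>\<alpha> \<beta>. - M j \<alpha> \<beta>) V \<alpha>)"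
      by (simp only: mat_vec_uminus diff_conv_add_uminus)
    \<comment> \<open>Here \<open>serX\<close> becomes \<open>gt\<close>, and the
      \<open>fsum A Vt\<close> inside \<open>gt\<close> combines with the negated \<open>M j\<close>
      to give the complementary matrix \<open>Mt j\<close>.\<close>
    from Vt[OF \<open>\<alpha> \<in> A\<close>] show "Vt \<alpha> = serY \<alpha> *
        (\<Prod>j\<leftarrow>[1..<k+1]. serX \<circ>\<^sub>X gt + mat_vec A (\<lambda>\<alpha> \<beta>. - M j \<alpha> \<beta>) Vt \<alpha>)"
      by (simp only: mat_vec_uminus Mt[OF Vt_fin] xcompose_serX gt diff_conv_add_uminus add.assoc)
  qed
  moreover have "gt \<circ>\<^sub>X g = - g + fsum A V"
    unfolding gt
  proof (rule xcompose_solution[OF g0, where js = "[1..<k+1]" and p = "- serX" and N = Mt])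
    fix \<alpha> assume "\<alpha> \<in> A"
    from Vt[OF this] show "Vt \<alpha> = serY \<alpha> * (\<Prod>j\<leftarrow>[1..<k+1]. - serX + mat_vec A (Mt j) Vt \<alpha>)" .
    \<comment> \<open>The term \<open>- fsum A V\<close> from \<open>- g\<close> cancels the
      all-ones part of \<open>Mt j\<close>.\<close>
    have "(- serX) \<circ>\<^sub>X g + mat_vec A (Mt j) V \<alpha> = serX - mat_vec A (M j) V \<alpha>" for j
      by (simp add: Mt[OF V_fin] xcompose_uminus[OF g0] xcompose_serX) (simp add: g)
    with V[OF \<open>\<alpha> \<in> A\<close>] show "V \<alpha> = serY \<alpha> *
        (\<Prod>j\<leftarrow>[1..<k+1]. (- serX) \<circ>\<^sub>X g + mat_vec A (Mt j) V \<alpha>)"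
      by (simp only:)
  qed
  \<comment> \<open>Each formal sum cancels against the one in \<open>g\<close> or
    \<open>gt\<close>, leaving \<open>serX\<close>.\<close>
  ultimately show ?thesis
    by (simp add: g gt)
qed

end
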